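(* Let $X$ be a Banach space as described in the context, let $f\in X$ and $\rho\in(0,\infty)$. Then $f$ is (the restriction to $\mathbb{D}$ of) an entire function of finite order $\rho$ if and only if $$\limsup_{n\to\infty}\frac{n\ln n}{\ln\frac{\|z^n\|}{E_n(f)}}=\rho .$$
   Context: $\mathbb{D}=\{z\in\mathbb{C}:|z|<1\}$. $X$ is a complex Banach space of functions analytic in $\mathbb{D}$ whose norm $\|\cdot\|$ satisfies: (i) $\|f(\cdot\, e^{it})\|=\|f(\cdot)\|$ for all $t\in\mathbb{R}$ and $f\in X$; (ii) $\|f\|<\infty$ for every entire function $f$; (iii) for all $f\in X$ and $g\in L[0,2\pi]$, $\big\|\frac{1}{2\pi}\int_0^{2\pi} f(ze^{it})g(t)\,dt\big\|\le \frac{1}{2\pi}\int_0^{2\pi}|g(t)|\,dt\cdot\|f\|$. For $n\ge 1$, $\mathcal{P}_n$ is the set of complex polynomials of degree at most $n-1$, $E_n(f)=\inf_{p\in\mathcal{P}_n}\|f-p\|$, and $\|z^n\|$ is the norm in $X$ of the monomial $z\mapsto z^n$. The order of an entire function $F$ is $\limsup_{r\to\infty}\frac{\ln\ln M(r)}{\ln r}$, $M(r)=\max_{|z|=r}|F(z)|$. *)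

theory Defs
  imports "HOL-Analysis.Analysis" "HOL-Computational_Algebra.Polynomial"
begin

text \<open>Functions analytic in the unit disc are represented by functions on the whole
  complex plane that vanish outside the open unit disc (so that equality in X is equality on D).\<close>

definition restrD :: "(complex \<Rightarrow> complex) \<Rightarrow> complex \<Rightarrow> complex" where
  "restrD F = (\<lambda>z. if z \<in> ball 0 1 then F z else 0)"

definition admissible_space :: "(complex \<Rightarrow> complex) set \<Rightarrow> ((complex \<Rightarrow> complex) \<Rightarrow> real) \<Rightarrow> bool" where
  "admissible_space X N \<longleftrightarrow>
     \<comment> \<open>elements are analytic functions on D (vanishing outside D)\<close>
     (\<forall>f\<in>X. f holomorphic_on ball 0 1 \<and> (\<forall>z. z \<notin> ball 0 1 \<longrightarrow> f z = 0)) \<and>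
     \<comment> \<open>complex vector space\<close>
     (\<lambda>z. 0) \<in> X \<and>
     (\<forall>f\<in>X. \<forall>g\<in>X. (\<lambda>z. f z + g z) \<in> X) \<and>
     (\<forall>f\<in>X. \<forall>c::complex. (\<lambda>z. c * f z) \<in> X) \<and>
     \<comment> \<open>norm\<close>
     (\<forall>f\<in>X. N f \<ge> 0) \<and>
     (\<forall>f\<in>X. N f = 0 \<longleftrightarrow> f = (\<lambda>z. 0)) \<and>
     (\<forall>f\<in>X. \<forall>c::complex. N (\<lambda>z. c * f z) = norm c * N f) \<and>
     (\<forall>f\<in>X. \<forall>g\<in>X. N (\<lambda>z. f z + g z) \<le> N f + N g) \<and>
     \<comment> \<open>completeness\<close>
     (\<forall>u::nat \<Rightarrow> complex \<Rightarrow> complex. (\<forall>n. u n \<in> X) \<longrightarrow>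
        (\<forall>e>0. \<exists>M. \<forall>m\<ge>M. \<forall>n\<ge>M. N (\<lambda>z. u m z - u n z) < e) \<longrightarrow>
        (\<exists>f\<in>X. (\<lambda>n. N (\<lambda>z. u n z - f z)) \<longlonglongrightarrow> 0)) \<and>
     \<comment> \<open>(i) rotation invariance\<close>
     (\<forall>f\<in>X. \<forall>t::real. (\<lambda>z. f (z * exp (\<i> * of_real t))) \<in> X \<and>
        N (\<lambda>z. f (z * exp (\<i> * of_real t))) = N f) \<and>
     \<comment> \<open>(ii) every entire function (restricted to D) has finite norm, i.e. lies in X\<close>
     (\<forall>F. F holomorphic_on UNIV \<longrightarrow> restrD F \<in> X) \<and>
     \<comment> \<open>(iii) convolution inequality, for g in L[0,2pi]\<close>
     (\<forall>f\<in>X. \<forall>g::real \<Rightarrow> complex. set_integrable lborel {0..2*pi} g \<longrightarrow>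
        (let h = restrD (\<lambda>z. (1 / (2*pi)) * (LINT t:{0..2*pi}|lborel. f (z * exp (\<i> * of_real t)) * g t))
         in h \<in> X \<and> N h \<le> (1 / (2*pi)) * (LINT t:{0..2*pi}|lborel. norm (g t)) * N f))"

definition monomial_fn :: "nat \<Rightarrow> complex \<Rightarrow> complex" where
  "monomial_fn n = restrD (\<lambda>z. z ^ n)"

text \<open>E_n(f): best approximation by polynomials of degree at most n-1 (n \<ge> 1).\<close>
definition best_approx :: "((complex \<Rightarrow> complex) \<Rightarrow> real) \<Rightarrow> nat \<Rightarrow> (complex \<Rightarrow> complex) \<Rightarrow> real" where
  "best_approx N n f = (INF p\<in>{p :: complex poly. degree p < n}. N (\<lambda>z. f z - restrD (poly p) z))"

definition max_modulus :: "(complex \<Rightarrow> complex) \<Rightarrow> real \<Rightarrow> real" where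
  "max_modulus F r = Sup ((\<lambda>z. norm (F z)) ` sphere 0 r)"

definition entire_order :: "(complex \<Rightarrow> complex) \<Rightarrow> ereal" where
  "entire_order F = Limsup at_top (\<lambda>r::real. ereal (ln (ln (max_modulus F r)) / ln r))"

end

(*
  Let v_n be the norm of z^n. Convolving with exp(-int) in (iii) gives |a_n| v_n <= N f for the Taylor
  coefficients a_n of every f in X. Applied to f - p this yields |a_n| v_n <= E_n(f), and completeness
  gives the converse bound of E_n(f) by the tail of the series of |a_k| v_k. Since X contains all entire
  functions and only functions analytic in the disc, v_n lies between (1/2)^n and R^n eventually. Such
  factors are negligible against n^(-n/sigma), so the decay rates of E_n(f) / v_n and of |a_n| on the
  scale n^(-n/sigma) agree, and by the Cauchy inequalities the latter is governed by the order of the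
  entire function.
*)
theory Submission
  imports Defs "HOL-Complex_Analysis.Complex_Analysis" "HOL-Real_Asymp.Real_Asymp"
begin

text \<open>Passing from growth to coefficients, back, and from coefficients to approximation costs
  constants or geometric factors, hence an arbitrarily small increase of the exponent. The two
  orders are therefore compared only through strict inequalities against positive reals, and
  equality is recovered from these at the end. The main obstacle is the converse direction. For
  E_n(f) >= v_n the quotient in the limsup is at most 0, so an upper bound for the limsup says
  nothing at such indices. Since \<rho> > 0, there are infinitely many n with E_n(f) < v_n, and the
  two-sided bound on v_n carries this from one late index to all later ones. The axioms do not state
  that norm convergence implies pointwise convergence. The coefficient inequality takes its place:
  it makes each Taylor coefficient continuous in the norm, and coefficients determine the
  function.\<close>

section \<open>Growth and Taylor coefficients of entire functions\<close>

text \<open>This is \<open>n\<close> to the power \<open>- n / \<sigma>\<close>, with value \<open>1\<close> at \<open>n = 0\<close> because \<open>ln 0 = 0\<close>.\<close>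
definition order_decay :: "real \<Rightarrow> nat \<Rightarrow> real" where
  "order_decay \<sigma> n = exp (- (real n * ln (real n) / \<sigma>))"

lemma order_decay_pos [simp]: "0 < order_decay \<sigma> n" "0 \<le> order_decay \<sigma> n"
  by (simp_all add: order_decay_def)

lemma order_decay_le_one: "0 < \<sigma> \<Longrightarrow> order_decay \<sigma> n \<le> 1"
  by (cases n) (auto simp: order_decay_def)

lemma order_decay_antimono:
  assumes "0 < \<sigma>" "m \<le> n"
  shows "order_decay \<sigma> n \<le> order_decay \<sigma> m"
proof -
  have "real m * ln (real m) \<le> real n * ln (real n)"
    using assms(2) by (cases "m = 0"; cases "n = 0") (auto intro!: mult_mono)
  then show ?thesis using assms(1) by (simp add: order_decay_def divide_right_mono)
qed

text \<open>In the exponent a geometric factor costs only O(n), while \<sigma> < \<sigma>' frees a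
  positive multiple of n ln n. The steps from growth to coefficients and from coefficients to
  approximation spend their loss here.\<close>

lemma eventually_order_decay_absorbs_power:
  assumes "0 < \<sigma>" "\<sigma> < \<sigma>'" "0 < R"
  shows "eventually (\<lambda>n. R ^ n * order_decay \<sigma> n \<le> order_decay \<sigma>' n) sequentially"
proof -
  define \<delta> where "\<delta> = 1 / \<sigma> - 1 / \<sigma>'"
  have \<delta>: "0 < \<delta>" using assms by (simp add: \<delta>_def frac_less2)
  have "eventually (\<lambda>n::nat. ln R / \<delta> \<le> ln (real n)) sequentially"
    by real_asymp
  then show ?thesis
  proof eventually_elim
    case (elim n)
    then have "ln R \<le> \<delta> * ln (real n)" using \<delta> by (simp add: field_simps)
    then have "real n * ln R \<le> real n * (\<delta> * ln (real n))" by (simp add: mult_left_mono)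
    then have "real n * ln R - real n * ln (real n) / \<sigma> \<le> - (real n * ln (real n) / \<sigma>')"
      by (simp add: \<delta>_def algebra_simps)
    moreover have "R ^ n = exp (real n * ln R)"
      using assms by (simp add: exp_of_nat_mult)
    ultimately show ?case by (simp add: order_decay_def flip: exp_add)
  qed
qed

lemma eventually_order_decay_mult_power_le:
  assumes "0 < \<sigma>" "0 < R" "0 < c"
  shows "eventually (\<lambda>n. R ^ n * order_decay \<sigma> n \<le> c ^ n) sequentially"
proof -
  \<comment> \<open>Dividing by c^n leaves a geometric factor with base R / c;
    \<open>\<sigma> + 1\<close> is just some larger exponent, whose decay factor is at most
    1.\<close>
  have "eventually (\<lambda>n. (R / c) ^ n * order_decay \<sigma> n \<le> order_decay (\<sigma> + 1) n) sequentially"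
    using assms by (intro eventually_order_decay_absorbs_power) auto
  then show ?thesis
  proof eventually_elim
    case (elim n)
    with order_decay_le_one[of "\<sigma> + 1" n] assms
    have "(R / c) ^ n * order_decay \<sigma> n \<le> 1" by linarith
    then show ?case using assms by (simp add: power_divide field_simps)
  qed
qed

text \<open>The maximum over real n is exp(x^\<sigma> / (e \<sigma>)), attained at n = x^\<sigma> /
  e. The inequality ln t <= t - 1 at t = x^\<sigma> / n gives the slightly weaker bound without
  calculus.\<close>

lemma order_decay_mult_power_le:
  assumes "0 < \<sigma>" "0 \<le> x"
  shows "order_decay \<sigma> n * x ^ n \<le> exp (x powr \<sigma> / \<sigma>)"
proof (cases "n = 0 \<or> x = 0")
  case True
  then show ?thesis using assms by (cases n) (auto simp: order_decay_def)
next
  case False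
  with assms have pos: "0 < real n" "0 < x" by auto
  have "ln (x powr \<sigma> / real n) \<le> x powr \<sigma> / real n - 1"
    using pos by (intro ln_le_minus_one) auto
  then have "\<sigma> * ln x - ln (real n) \<le> x powr \<sigma> / real n - 1"
    using pos by (simp add: ln_div)
  then have "real n / \<sigma> * (\<sigma> * ln x - ln (real n)) \<le> real n / \<sigma> * (x powr \<sigma> / real n - 1)"
    using pos assms by (intro mult_left_mono) auto
  also have "\<dots> \<le> x powr \<sigma> / \<sigma>"
    using pos assms(1) by (simp add: right_diff_distrib)
  finally have le: "real n * ln x - real n * ln (real n) / \<sigma> \<le> x powr \<sigma> / \<sigma>"
    using assms(1) by (simp add: right_diff_distrib)
  have xn: "x ^ n = exp (real n * ln x)"
    using pos by (simp add: exp_of_nat_mult)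
  have "order_decay \<sigma> n * x ^ n = exp (real n * ln x - real n * ln (real n) / \<sigma>)"
    unfolding order_decay_def xn exp_add[symmetric] by simp
  with le show ?thesis by simp
qed

lemma entire_power_series:
  fixes a :: "nat \<Rightarrow> complex"
  assumes "\<And>z. summable (\<lambda>n. a n * z ^ n)"
  shows "(\<lambda>z. \<Sum>n. a n * z ^ n) holomorphic_on UNIV"
proof -
  have "(\<lambda>z. \<Sum>n. a n * z ^ n) holomorphic_on ball 0 r" for r
    using assms by (intro power_series_holomorphic[of 0 r a]) (auto simp: summable_sums)
  then have "(\<lambda>z. \<Sum>n. a n * z ^ n) field_differentiable (at z)" for z
    by (rule holomorphic_on_imp_differentiable_at[of _ "ball 0 (norm z + 1)"]) auto
  then show ?thesis by (simp add: holomorphic_on_def)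
qed

lemma entire_taylor_sums:
  assumes "F holomorphic_on UNIV"
  shows "(\<lambda>n. (deriv ^^ n) F 0 / fact n * z ^ n) sums F z"
  using holomorphic_power_series[of F 0 "norm z + 1" z] holomorphic_on_subset[OF assms] by simp

text \<open>A limsup below \<rho> may a priori be negative or minus infinity, whereas the decay
  scale needs a positive exponent; taking the maximum with \<open>\<rho> / 2\<close> provides
  one.\<close>

lemma ereal_less_obtain_pos:
  assumes "x < ereal \<rho>" "0 < \<rho>"
  obtains \<tau> where "0 < \<tau>" "\<tau> < \<rho>" "x < ereal \<tau>"
proof -
  obtain \<sigma> where \<sigma>: "x < ereal \<sigma>" "ereal \<sigma> < ereal \<rho>" using ereal_dense2[OF assms(1)] by blast
  have "ereal \<sigma> \<le> ereal (max \<sigma> (\<rho> / 2))" by simp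
  with \<sigma>(1) have "x < ereal (max \<sigma> (\<rho> / 2))" by (rule less_le_trans)
  then show ?thesis using that[of "max \<sigma> (\<rho> / 2)"] \<sigma>(2) assms(2) by auto
qed

section \<open>Growth against decay of Taylor coefficients\<close>

text \<open>The growth condition is stated without the double logarithm, so it keeps its meaning
  where the maximum modulus is at most 1.\<close>

definition growth_below :: "(complex \<Rightarrow> complex) \<Rightarrow> real \<Rightarrow> bool" where
  "growth_below F \<sigma> \<longleftrightarrow>
     eventually (\<lambda>r. \<forall>z. norm z = r \<longrightarrow> norm (F z) \<le> exp (r powr \<sigma>)) at_top"

definition coeffs_below :: "(nat \<Rightarrow> complex) \<Rightarrow> real \<Rightarrow> bool" where
  "coeffs_below a \<sigma> \<longleftrightarrow> eventually (\<lambda>n. norm (a n) \<le> order_decay \<sigma> n) sequentially"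

lemma eventually_le_imp_const_bound:
  fixes a :: "nat \<Rightarrow> 'a::real_normed_vector"
  assumes "eventually (\<lambda>n. norm (a n) \<le> d n) sequentially" "\<And>n. 0 < d n"
  obtains K where "0 < K" "\<And>n. norm (a n) \<le> K * d n"
proof -
  obtain M where M: "\<And>n. n \<ge> M \<Longrightarrow> norm (a n) \<le> d n"
    using assms(1) by (auto simp: eventually_sequentially)
  \<comment> \<open>The summand 1 serves the indices from \<open>M\<close> on; the sum of ratios
    dominates each of the finitely many earlier ones.\<close>
  define K where "K = 1 + (\<Sum>n<M. norm (a n) / d n)"
  have K1: "1 \<le> K" unfolding K_def
    using assms(2) by (auto intro!: sum_nonneg simp: less_imp_le)
  have bound: "norm (a n) \<le> K * d n" for n
  proof (cases "n < M")
    case True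
    have "norm (a n) / d n \<le> (\<Sum>n<M. norm (a n) / d n)"
      using True assms(2) by (intro member_le_sum) (auto simp: less_imp_le)
    then have "norm (a n) / d n \<le> K" by (simp add: K_def)
    then show ?thesis using assms(2)[of n] by (simp add: field_simps)
  next
    case False
    then have "norm (a n) \<le> 1 * d n" using M by auto
    also have "\<dots> \<le> K * d n" using K1 assms(2)[of n] by (intro mult_right_mono) auto
    finally show ?thesis .
  qed
  show ?thesis using that[OF _ bound] K1 by linarith
qed

text \<open>The decay bound is applied at 2|z| instead of |z|. This leaves a factor (1/2)^n, which
  turns a bound uniform in n into a summable majorant.\<close>

lemma coeffs_below_term_bound:
  fixes a :: "nat \<Rightarrow> complex"
  assumes "0 < \<sigma>" "\<And>n. norm (a n) \<le> K * order_decay \<sigma> n" "0 < K"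
  shows "norm (a n * z ^ n) \<le> K * exp ((2 * norm z) powr \<sigma> / \<sigma>) * (1/2) ^ n"
proof -
  have nz: "norm z ^ n = (2 * norm z) ^ n * (1/2) ^ n"
    unfolding power_mult_distrib[symmetric] by simp
  have "norm (a n * z ^ n) \<le> K * order_decay \<sigma> n * norm z ^ n"
    using assms(2)[of n] by (simp add: norm_mult norm_power mult_right_mono)
  also have "\<dots> = K * (order_decay \<sigma> n * (2 * norm z) ^ n) * (1/2) ^ n"
    by (simp only: nz mult.assoc)
  also have "\<dots> \<le> K * exp ((2 * norm z) powr \<sigma> / \<sigma>) * (1/2) ^ n"
    using assms by (intro mult_right_mono mult_left_mono order_decay_mult_power_le) auto
  finally show ?thesis .
qed

lemma coeffs_below_summable:
  assumes "0 < \<sigma>" "coeffs_below a \<sigma>"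
  shows "summable (\<lambda>n. norm (a n * z ^ n))"
proof -
  obtain K where K: "0 < K" "\<And>n. norm (a n) \<le> K * order_decay \<sigma> n"
    using eventually_le_imp_const_bound[of a "order_decay \<sigma>"] assms(2)
    by (auto simp: coeffs_below_def)
  have "summable (\<lambda>n. K * exp ((2 * norm z) powr \<sigma> / \<sigma>) * (1/2) ^ n)"
    by (intro summable_mult summable_geometric) auto
  then show ?thesis
    by (rule summable_comparison_test')
      (use coeffs_below_term_bound[OF assms(1) K(2,1)] in auto)
qed

lemma coeffs_below_imp_growth_below:
  assumes "0 < \<sigma>" "\<sigma> < \<sigma>'" "coeffs_below a \<sigma>" and sums: "\<And>z. (\<lambda>n. a n * z ^ n) sums F z"
  shows "growth_below F \<sigma>'"
proof -
  obtain K where K: "0 < K" "\<And>n. norm (a n) \<le> K * order_decay \<sigma> n"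
    using eventually_le_imp_const_bound[of a "order_decay \<sigma>"] assms(3)
    by (auto simp: coeffs_below_def)
  have bound: "norm (F z) \<le> 2 * K * exp ((2 * norm z) powr \<sigma> / \<sigma>)" for z
  proof -
    let ?C = "K * exp ((2 * norm z) powr \<sigma> / \<sigma>)"
    have s: "(\<lambda>n. ?C * (1/2) ^ n) sums (?C * 2)"
      using geometric_sums[of "1/2::real"] by (intro sums_mult) auto
    have "norm (\<Sum>n. a n * z ^ n) \<le> (\<Sum>n. ?C * (1/2) ^ n)"
      using s coeffs_below_term_bound[OF assms(1) K(2,1)]
      by (intro norm_suminf_le) (auto simp: sums_iff)
    then show ?thesis using sums[of z] s by (simp add: sums_iff mult_ac)
  qed
  \<comment> \<open>Summation gives the exponent ln(2K) + (2r)^\<sigma> / \<sigma>; its constants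
    are absorbed by r^(\<sigma>' - \<sigma>), which tends to infinity.\<close>
  have "eventually (\<lambda>r::real. \<bar>ln (2 * K)\<bar> + 2 powr \<sigma> / \<sigma> \<le> r powr (\<sigma>' - \<sigma>)) at_top"
    using assms(2) by real_asymp
  then have "eventually (\<lambda>r::real. ln (2 * K) + 2 powr \<sigma> / \<sigma> * r powr \<sigma> \<le> r powr \<sigma>') at_top"
    using eventually_ge_at_top[of 1]
  proof eventually_elim
    case (elim r)
    have "1 \<le> r powr \<sigma>" using elim assms(1) by (simp add: ge_one_powr_ge_zero)
    then have "ln (2 * K) \<le> \<bar>ln (2 * K)\<bar> * r powr \<sigma>"
      by (smt (verit) mult_le_cancel_left1)
    then have "ln (2 * K) + 2 powr \<sigma> / \<sigma> * r powr \<sigma> \<le> (\<bar>ln (2 * K)\<bar> + 2 powr \<sigma> / \<sigma>) * r powr \<sigma>"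
      by (simp add: algebra_simps)
    also have "\<dots> \<le> r powr (\<sigma>' - \<sigma>) * r powr \<sigma>"
      using elim by (intro mult_right_mono) auto
    also have "\<dots> = r powr \<sigma>'" by (simp flip: powr_add)
    finally show ?case .
  qed
  then show ?thesis unfolding growth_below_def using eventually_gt_at_top[of 0]
  proof eventually_elim
    case (elim r)
    show ?case
    proof (intro allI impI)
      fix z :: complex assume z: "norm z = r"
      have "norm (F z) \<le> exp (ln (2 * K) + (2 powr \<sigma> / \<sigma>) * r powr \<sigma>)"
        using bound[of z] z elim K(1) by (simp add: exp_add powr_mult)
      also have "\<dots> \<le> exp (r powr \<sigma>')" using elim by simp
      finally show "norm (F z) \<le> exp (r powr \<sigma>')" .
    qed
  qed
qed

lemma growth_below_imp_coeffs_below: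
  assumes "0 < \<sigma>" "\<sigma> < \<sigma>'" "F holomorphic_on UNIV" "growth_below F \<sigma>"
  shows "coeffs_below (\<lambda>n. (deriv ^^ n) F 0 / fact n) \<sigma>'"
proof -
  obtain r0 where r0: "\<And>r z. r \<ge> r0 \<Longrightarrow> norm z = r \<Longrightarrow> norm (F z) \<le> exp (r powr \<sigma>)"
    using assms(4) by (auto simp: growth_below_def eventually_at_top_linorder)
  have "eventually (\<lambda>n::nat. r0 \<le> real n powr (1 / \<sigma>)) sequentially"
    using assms(1) by real_asymp
  moreover have "eventually (\<lambda>n. exp 1 ^ n * order_decay \<sigma> n \<le> order_decay \<sigma>' n) sequentially"
    by (intro eventually_order_decay_absorbs_power) (use assms in auto)
  ultimately show ?thesis unfolding coeffs_below_def using eventually_gt_at_top[of 0]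
  proof eventually_elim
    case (elim n)
    \<comment> \<open>Up to a constant factor this radius minimises exp(r^\<sigma>) / r^n in
      Cauchy's inequality. It makes r^n the exact reciprocal of
      \<open>order_decay \<sigma> n\<close> and leaves only the geometric factor e^n.\<close>
    define r where "r = real n powr (1 / \<sigma>)"
    have r: "0 < r" "r0 \<le> r" using elim by (auto simp: r_def)
    have rs: "r powr \<sigma> = real n" using elim assms(1) by (simp add: r_def powr_powr)
    have rn: "1 / r ^ n = order_decay \<sigma> n"
    proof -
      have "r ^ n = r powr real n" using r by (simp add: powr_realpow)
      also have "\<dots> = exp (real n * ln (real n) / \<sigma>)"
        using elim by (simp add: r_def powr_powr powr_def mult_ac)
      finally show ?thesis by (simp add: order_decay_def exp_minus field_simps)
    qed
    have "norm ((deriv ^^ n) F 0) \<le> fact n * exp (r powr \<sigma>) / r ^ n"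
      using r r0[of r] assms(3)
      by (intro Cauchy_inequality)
        (auto intro: holomorphic_on_subset holomorphic_on_imp_continuous_on)
    then have "norm ((deriv ^^ n) F 0 / fact n) \<le> exp (real n) * (1 / r ^ n)"
      by (simp add: norm_divide rs field_simps)
    also have "\<dots> = exp 1 ^ n * order_decay \<sigma> n" by (simp add: rn exp_of_nat_mult[of n 1, simplified])
    finally show ?case using elim by simp
  qed
qed

section \<open>Order and maximum modulus\<close>

lemma norm_le_max_modulus:
  assumes "F holomorphic_on UNIV" "norm z = r"
  shows "norm (F z) \<le> max_modulus F r"
proof -
  have "compact ((\<lambda>z. norm (F z)) ` sphere 0 r)"
    using assms(1) by (intro compact_continuous_image continuous_intros compact_sphere)
      (auto intro: holomorphic_on_subset holomorphic_on_imp_continuous_on)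
  then show ?thesis unfolding max_modulus_def
    using assms(2) by (intro cSup_upper) (auto intro: bounded_imp_bdd_above compact_imp_bounded)
qed

lemma max_modulus_le:
  assumes "0 \<le> r" "\<And>z. norm z = r \<Longrightarrow> norm (F z) \<le> B"
  shows "max_modulus F r \<le> B"
  unfolding max_modulus_def
  using assms by (intro cSup_least) (auto intro!: exI[of _ "of_real r"])

lemma entire_order_less_imp_growth_below:
  assumes "F holomorphic_on UNIV" "entire_order F < ereal \<sigma>"
  shows "growth_below F \<sigma>"
proof -
  have "eventually (\<lambda>r. ereal (ln (ln (max_modulus F r)) / ln r) < ereal \<sigma>) at_top"
    using assms(2) unfolding entire_order_def by (rule Limsup_lessD)
  then show ?thesis unfolding growth_below_def using eventually_gt_at_top[of 1]
  proof eventually_elim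
    case (elim r)
    have "max_modulus F r \<le> exp (r powr \<sigma>)"
    \<comment> \<open>If the maximum modulus is at most 1, the double logarithm carries no
      information, but the bound holds since its right-hand side is at least 1.\<close>
    proof (cases "1 < max_modulus F r")
      case True
      have "ln (ln (max_modulus F r)) < \<sigma> * ln r" using elim by (simp add: field_simps)
      then have "ln (max_modulus F r) < exp (\<sigma> * ln r)"
        using True by (metis exp_less_cancel_iff exp_ln ln_gt_zero)
      also have "\<dots> = r powr \<sigma>" using elim by (simp add: powr_def)
      finally show ?thesis using True
        by (metis exp_le_cancel_iff exp_ln less_eq_real_def order_less_trans zero_less_one)
    next
      case False
      then show ?thesis using elim
        by (smt (verit) exp_ge_zero one_le_exp_iff powr_ge_zero)
    qed
    then show ?case using norm_le_max_modulus[OF assms(1)] order_trans by blast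
  qed
qed

text \<open>Constant functions are treated apart: if \<^term>\<open>max_modulus F r\<close> does not exceed \<^term>\<open>1\<close>, the
  double logarithm is a junk value.\<close>
lemma growth_below_imp_entire_order_le:
  assumes "F holomorphic_on UNIV" "0 < \<sigma>" "growth_below F \<sigma>"
  shows "entire_order F \<le> ereal \<sigma>"
proof (cases "\<exists>k>0. (deriv ^^ k) F 0 \<noteq> 0")
  case True
  then obtain k where k: "k > 0" "(deriv ^^ k) F 0 \<noteq> 0" by auto
  define c where "c = norm ((deriv ^^ k) F 0) / fact k"
  have c: "c > 0" using k by (simp add: c_def)
  \<comment> \<open>A single nonzero derivative of positive order forces the maximum modulus to
    infinity. Once it reaches e, its logarithm is at least 1 and the outer logarithm is monotone
    there.\<close>
  have lower: "c * r ^ k \<le> max_modulus F r" if "r > 0" for r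
  proof -
    have "norm ((deriv ^^ k) F 0) \<le> fact k * max_modulus F r / r ^ k"
      using that assms(1) norm_le_max_modulus[OF assms(1)]
      by (intro Cauchy_inequality)
        (auto intro: holomorphic_on_subset holomorphic_on_imp_continuous_on)
    then show ?thesis using that by (simp add: c_def field_simps)
  qed
  have "eventually (\<lambda>r::real. exp 1 \<le> c * r ^ k) at_top"
    using eventually_ge_at_top[of 1] eventually_ge_at_top[of "exp 1 / c"]
  proof eventually_elim
    case (elim r)
    have "exp 1 \<le> c * r" using elim c by (simp add: field_simps)
    also have "\<dots> \<le> c * r ^ k" using elim c k by (simp add: self_le_power)
    finally show ?case .
  qed
  then have "eventually (\<lambda>r. ereal (ln (ln (max_modulus F r)) / ln r) \<le> ereal \<sigma>) at_top"
    using assms(3)[unfolded growth_below_def] eventually_gt_at_top[of 1]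
  proof eventually_elim
    case (elim r)
    have M: "exp 1 \<le> max_modulus F r" using elim lower[of r] by simp
    then have pos: "0 < max_modulus F r" by (meson exp_gt_zero less_le_trans)
    have "max_modulus F r \<le> exp (r powr \<sigma>)" using elim by (intro max_modulus_le) auto
    then have "ln (max_modulus F r) \<le> r powr \<sigma>" using pos by (metis exp_gt_zero ln_exp ln_mono)
    moreover have "1 \<le> ln (max_modulus F r)" using M pos by (simp add: ln_ge_iff)
    ultimately have "ln (ln (max_modulus F r)) \<le> ln (r powr \<sigma>)" by (intro ln_mono) auto
    then show ?case using elim by (simp add: field_simps)
  qed
  then show ?thesis unfolding entire_order_def by (rule Limsup_bounded)
next
  case False
  have const: "F z = F 0" for z
  proof -
    have "(\<lambda>n. (deriv ^^ n) F 0 / fact n * z ^ n) sums F z"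
      by (rule entire_taylor_sums[OF assms(1)])
    moreover have "(\<lambda>n. (deriv ^^ n) F 0 / fact n * z ^ n) = (\<lambda>n. if n = 0 then F 0 else 0)"
    proof
      fix n
      show "(deriv ^^ n) F 0 / fact n * z ^ n = (if n = 0 then F 0 else 0)"
        using False by (cases n) auto
    qed
    ultimately show ?thesis using sums_single[of 0 "\<lambda>_. F 0"] sums_unique2 by metis
  qed
  have M: "max_modulus F r = norm (F 0)" if "r > 0" for r
    using norm_le_max_modulus[OF assms(1), of "of_real r" r] max_modulus_le[of r F "norm (F 0)"] that
      const by (metis abs_of_pos less_imp_le norm_of_real order_antisym order_refl)
  have "eventually (\<lambda>r. ereal (ln (ln (max_modulus F r)) / ln r) = ereal (ln (ln (norm (F 0))) / ln r)) at_top"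
    using eventually_gt_at_top[of 0] by eventually_elim (simp add: M)
  then have "entire_order F = Limsup at_top (\<lambda>r. ereal (ln (ln (norm (F 0))) / ln r))"
    unfolding entire_order_def by (rule Limsup_eq)
  also have "\<dots> = ereal 0"
  proof (rule lim_imp_Limsup)
    \<comment> \<open>Whatever value the double logarithm of the constant has, division by ln r
      sends it to 0, which is below \<sigma>.\<close>
    have "((\<lambda>r. ln (ln (norm (F 0))) / ln r) \<longlongrightarrow> 0) at_top" by real_asymp
    then show "((\<lambda>r. ereal (ln (ln (norm (F 0))) / ln r)) \<longlongrightarrow> ereal 0) at_top" by (simp add: zero_ereal_def)
  qed simp
  finally show ?thesis using assms by (simp add: zero_ereal_def)
qed

section \<open>Taylor coefficients in an admissible space\<close>

text \<open>Coefficients form a sequence related to the function rather than derivatives at 0, so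
  those of differences, polynomials and partial sums can be read off termwise.\<close>

definition disc_series :: "(complex \<Rightarrow> complex) \<Rightarrow> (nat \<Rightarrow> complex) \<Rightarrow> bool" where
  "disc_series f a \<longleftrightarrow> (\<forall>z\<in>ball 0 1. (\<lambda>n. a n * z ^ n) sums f z)"

lemma disc_series_diff:
  assumes "disc_series f a" "disc_series g b"
  shows "disc_series (\<lambda>z. f z - g z) (\<lambda>n. a n - b n)"
  using assms by (auto simp: disc_series_def left_diff_distrib intro!: sums_diff)

lemma restrD_disc_series_iff: "disc_series (restrD F) a \<longleftrightarrow> disc_series F a"
  by (simp add: disc_series_def restrD_def)

lemma poly_sums: "(\<lambda>n. coeff p n * z ^ n) sums poly p (z :: complex)"
  unfolding poly_altdef by (intro sums_finite) (auto simp: coeff_eq_0)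

lemma disc_series_summable_norm:
  assumes "disc_series f a" "norm z < 1"
  shows "summable (\<lambda>n. norm (a n * z ^ n))"
proof -
  define w :: complex where "w = of_real ((1 + norm z) / 2)"
  have nw: "norm w = (1 + norm z) / 2"
    unfolding w_def norm_of_real by simp
  have "summable (\<lambda>n. a n * w ^ n)"
    using assms nw by (auto simp: disc_series_def dest!: bspec[of _ _ w] intro: sums_summable)
  then show ?thesis using assms nw by (intro powser_insidea[of a w z]) auto
qed

lemma set_integral_exp_imaginary:
  "(LINT t:{0..2*pi}|lborel. exp (\<i> * of_int k * of_real t)) = (if k = 0 then of_real (2 * pi) else (0::complex))"
proof (cases "k = 0")
  case True
  then show ?thesis by (simp add: set_lebesgue_integral_def scaleR_conv_of_real)
next
  case False
  let ?F = "\<lambda>t::real. exp (\<i> * of_int k * of_real t) / (\<i> * of_int k) :: complex"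
  have "(LINT t:{0..2*pi}|lborel. exp (\<i> * of_int k * of_real t)) = ?F (2 * pi) - ?F 0"
    unfolding set_lebesgue_integral_def
  proof (rule integral_FTC_Icc)
    fix t :: real
    show "(?F has_vector_derivative exp (\<i> * of_int k * of_real t)) (at t within {0..2*pi})"
      using False by (auto intro!: derivative_eq_intros has_vector_derivative_real_field
        simp: field_simps)
  qed (auto intro!: continuous_intros)
  also have "exp (\<i> * of_int k * of_real (2 * pi)) = (1::complex)"
    using exp_integer_2pi[of "of_int k"] by (simp add: mult_ac)
  finally show ?thesis using False by simp
qed

text \<open>Absolute convergence on the circle through z allows termwise integration, and by
  orthogonality of the characters only the term k = n survives.\<close>

lemma fourier_coefficient_disc_series:
  assumes "disc_series f a" "norm z < 1"
  shows "(LINT t:{0..2*pi}|lborel. f (z * exp (\<i> * of_real t)) * exp (- (\<i> * of_nat n * of_real t)))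
           = of_real (2 * pi) * (a n * z ^ n)"
proof -
  let ?S = "{0..2*pi}"
  define g where "g k t = a k * z ^ k * exp (\<i> * of_int (int k - int n) * of_real t)" for k and t :: real
  define G where "G k t = indicator ?S t *\<^sub>R g k t" for k t
  have ng: "norm (g k t) = norm (a k * z ^ k)" for k t
    by (simp add: g_def norm_mult)
  have gs: "(\<lambda>k. g k t) sums (f (z * exp (\<i> * of_real t)) * exp (- (\<i> * of_nat n * of_real t)))" for t
  proof -
    have "(\<lambda>k. a k * (z * exp (\<i> * of_real t)) ^ k * exp (- (\<i> * of_nat n * of_real t))) sums
        (f (z * exp (\<i> * of_real t)) * exp (- (\<i> * of_nat n * of_real t)))"
      using assms by (intro sums_mult2) (auto simp: disc_series_def norm_mult)
    moreover have "a k * (z * exp (\<i> * of_real t)) ^ k * exp (- (\<i> * of_nat n * of_real t)) = g k t" for k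
      by (simp add: g_def power_mult_distrib algebra_simps flip: exp_of_nat_mult exp_add)
    ultimately show ?thesis by simp
  qed
  have Gint: "integrable lborel (G k)" for k
    unfolding G_def g_def by (intro borel_integrable_compact continuous_intros) auto
  have sumn: "summable (\<lambda>k. norm (a k * z ^ k))"
    using assms by (rule disc_series_summable_norm)
  have "(\<lambda>k. integral\<^sup>L lborel (G k)) sums (\<integral>t. (\<Sum>k. G k t) \<partial>lborel)"
  proof (rule sums_integral[OF Gint])
    show "AE t in lborel. summable (\<lambda>k. norm (G k t))"
      using sumn by (intro AE_I2) (auto simp: G_def ng intro!: summable_mult)
    have "(\<integral>t. norm (G k t) \<partial>lborel) = 2 * pi * norm (a k * z ^ k)" for k
      by (simp add: G_def ng)
    then show "summable (\<lambda>k. \<integral>t. norm (G k t) \<partial>lborel)"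
      using sumn by (auto intro!: summable_mult)
  qed
  moreover have "(\<Sum>k. G k t) = indicator ?S t *\<^sub>R (f (z * exp (\<i> * of_real t)) * exp (- (\<i> * of_nat n * of_real t)))" for t
    using sums_scaleR_right[OF gs[of t], of "indicator ?S t"] by (simp add: G_def sums_iff)
  moreover have "integral\<^sup>L lborel (G k) = (if k = n then of_real (2 * pi) * (a n * z ^ n) else 0)" for k
  proof -
    have "integral\<^sup>L lborel (G k) = a k * z ^ k * (LINT t:?S|lborel. exp (\<i> * of_int (int k - int n) * of_real t))"
      unfolding set_lebesgue_integral_def G_def g_def
      by (simp add: mult_scaleR_right[symmetric] del: mult_scaleR_right of_int_diff)
    then show ?thesis by (subst (asm) set_integral_exp_imaginary) auto
  qed
  ultimately have "(\<lambda>k. if k = n then of_real (2 * pi) * (a n * z ^ n) else 0) sums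
      (LINT t:?S|lborel. f (z * exp (\<i> * of_real t)) * exp (- (\<i> * of_nat n * of_real t)))"
    by (simp add: set_lebesgue_integral_def)
  then show ?thesis using sums_single[of n "\<lambda>_. of_real (2 * pi) * (a n * z ^ n)"] sums_unique2 by blast
qed

locale admissible =
  fixes X :: "(complex \<Rightarrow> complex) set" and N :: "(complex \<Rightarrow> complex) \<Rightarrow> real"
  assumes admissible_space: "admissible_space X N"
begin

lemmas space_axioms = admissible_space[unfolded admissible_space_def]

lemmas X_analytic = space_axioms[THEN conjunct1]
lemmas space_axioms2 = space_axioms[THEN conjunct2, THEN conjunct2]
lemmas X_add = space_axioms2[THEN conjunct1, rule_format]
lemmas X_scale = space_axioms2[THEN conjunct2, THEN conjunct1, rule_format]
lemmas space_axioms4 = space_axioms2[THEN conjunct2, THEN conjunct2]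
lemmas N_nonneg = space_axioms4[THEN conjunct1, rule_format]
lemmas N_eq_0_iff = space_axioms4[THEN conjunct2, THEN conjunct1, rule_format]
lemmas space_axioms6 = space_axioms4[THEN conjunct2, THEN conjunct2]
lemmas N_scale = space_axioms6[THEN conjunct1, rule_format]
lemmas N_add = space_axioms6[THEN conjunct2, THEN conjunct1, rule_format]
lemmas space_axioms8 = space_axioms6[THEN conjunct2, THEN conjunct2]
lemmas X_complete = space_axioms8[THEN conjunct1]
lemmas space_axioms10 = space_axioms8[THEN conjunct2, THEN conjunct2]
lemmas X_entire = space_axioms10[THEN conjunct1, rule_format]
lemmas X_convolution = space_axioms10[THEN conjunct2, rule_format]

lemma X_zero: "(\<lambda>z. 0) \<in> X" "N (\<lambda>z. 0) = 0"
  using space_axioms[THEN conjunct2, THEN conjunct1] N_eq_0_iff by auto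

lemma X_holomorphic: "f \<in> X \<Longrightarrow> f holomorphic_on ball 0 1"
  and X_vanish: "f \<in> X \<Longrightarrow> z \<notin> ball 0 1 \<Longrightarrow> f z = 0"
  using X_analytic by blast+

lemma X_diff: "f \<in> X \<Longrightarrow> g \<in> X \<Longrightarrow> (\<lambda>z. f z - g z) \<in> X"
  using X_add[of f "\<lambda>z. - 1 * g z"] X_scale[of g "- 1"] by simp

lemma N_diff_commute: "f \<in> X \<Longrightarrow> g \<in> X \<Longrightarrow> N (\<lambda>z. f z - g z) = N (\<lambda>z. g z - f z)"
  using N_scale[OF X_diff[of f g], of "- 1"] by simp

lemma N_triangle:
  assumes "f \<in> X" "g \<in> X" "h \<in> X"
  shows "N (\<lambda>z. f z - h z) \<le> N (\<lambda>z. f z - g z) + N (\<lambda>z. g z - h z)"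
  using N_add[OF X_diff[of f g] X_diff[of g h]] assms by simp

lemma disc_series_deriv:
  assumes "f \<in> X"
  shows "disc_series f (\<lambda>n. (deriv ^^ n) f 0 / fact n)"
  unfolding disc_series_def
  using holomorphic_power_series[OF X_holomorphic[OF assms]] by simp

text \<open>Elements of \<open>X\<close> vanish outside the disc, so agreement of their series there
  is equality of functions.\<close>

lemma disc_series_inj:
  assumes "f \<in> X" "g \<in> X" "disc_series f a" "disc_series g a"
  shows "f = g"
proof
  fix z
  show "f z = g z"
    using assms X_vanish[of f z] X_vanish[of g z]
    by (cases "z \<in> ball 0 1") (auto simp: disc_series_def dest!: bspec intro: sums_unique2)
qed

lemma monomial_in_X: "monomial_fn n \<in> X"
  unfolding monomial_fn_def by (intro X_entire holomorphic_intros)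

lemma N_monomial_pos: "0 < N (monomial_fn n)"
proof -
  have "monomial_fn n (1/2) \<noteq> 0" by (simp add: monomial_fn_def restrD_def)
  then have "monomial_fn n \<noteq> (\<lambda>z. 0)" by metis
  then show ?thesis using N_nonneg[OF monomial_in_X] N_eq_0_iff[OF monomial_in_X] by (metis less_eq_real_def)
qed

text \<open>Convolution with the character \<open>exp (- i n t)\<close> projects a function onto its \<open>n\<close>-th Taylor term.\<close>
lemma coefficient_bound:
  assumes f: "f \<in> X" and a: "disc_series f a"
  shows "norm (a n) * N (monomial_fn n) \<le> N f"
proof -
  define g where "g t = exp (- (\<i> * of_nat n * of_real t))" for t :: real
  have gint: "set_integrable lborel {0..2*pi} g"
    unfolding g_def by (intro borel_integrable_atLeastAtMost' continuous_intros)
  let ?h = "restrD (\<lambda>z. (1 / (2*pi)) * (LINT t:{0..2*pi}|lborel. f (z * exp (\<i> * of_real t)) * g t))"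
  have "?h = (\<lambda>z. a n * monomial_fn n z)"
    using fourier_coefficient_disc_series[OF a]
    by (auto simp: restrD_def monomial_fn_def g_def fun_eq_iff)
  then have "N ?h = norm (a n) * N (monomial_fn n)"
    using N_scale[OF monomial_in_X] by simp
  moreover have "N ?h \<le> (1 / (2*pi)) * (LINT t:{0..2*pi}|lborel. norm (g t)) * N f"
    using X_convolution[OF f gint] by (simp only: Let_def)
  moreover have "(LINT t:{0..2*pi}|lborel. norm (g t)) = 2 * pi"
    by (simp add: g_def set_lebesgue_integral_def)
  ultimately show ?thesis by simp
qed

section \<open>Norm convergent series of monomials\<close>

text \<open>Arbitrary index sets cover both the partial sums and the blocks between two of
  them.\<close>

definition monomial_sum :: "(nat \<Rightarrow> complex) \<Rightarrow> nat set \<Rightarrow> complex \<Rightarrow> complex" where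
  "monomial_sum b A = (\<lambda>z. \<Sum>k\<in>A. b k * monomial_fn k z)"

lemma monomial_sum_in_X_and_bound:
  assumes "finite A"
  shows "monomial_sum b A \<in> X \<and> N (monomial_sum b A) \<le> (\<Sum>k\<in>A. norm (b k) * N (monomial_fn k))"
  using assms
proof (induction A)
  case empty
  then show ?case by (simp add: monomial_sum_def X_zero)
next
  case (insert k A)
  have m: "(\<lambda>z. b k * monomial_fn k z) \<in> X" by (intro X_scale monomial_in_X)
  have eq: "monomial_sum b (insert k A) = (\<lambda>z. b k * monomial_fn k z + monomial_sum b A z)"
    using insert by (simp add: monomial_sum_def)
  show ?case unfolding eq
    using X_add[OF m] N_add[OF m] insert N_scale[OF monomial_in_X] by fastforce
qed

lemmas monomial_sum_in_X = monomial_sum_in_X_and_bound[THEN conjunct1]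
lemmas N_monomial_sum_le = monomial_sum_in_X_and_bound[THEN conjunct2]

lemma disc_series_monomial_sum:
  "finite A \<Longrightarrow> disc_series (monomial_sum b A) (\<lambda>k. if k \<in> A then b k else 0)"
  unfolding disc_series_def
proof
  fix z :: complex assume "finite A" "z \<in> ball 0 1"
  then show "(\<lambda>n. (if n \<in> A then b n else 0) * z ^ n) sums monomial_sum b A z"
    using sums_finite[of A "\<lambda>n. (if n \<in> A then b n else 0) * z ^ n"]
    by (auto simp: monomial_sum_def monomial_fn_def restrD_def)
qed

text \<open>Absolute convergence makes the partial sums Cauchy, and completeness gives a limit
  \<open>g\<close>, known only as a norm limit. That its Taylor coefficients are the
  \<open>b n\<close> has to be derived from \<open>coefficient_bound\<close>.\<close>

lemma monomial_series_converges:
  assumes summ: "summable (\<lambda>n. norm (b n) * N (monomial_fn n))"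
  obtains g where "g \<in> X" "disc_series g b"
    "\<And>n. N (\<lambda>z. g z - monomial_sum b {..<n} z) \<le> (\<Sum>k. norm (b (k + n)) * N (monomial_fn (k + n)))"
proof -
  let ?c = "\<lambda>n. norm (b n) * N (monomial_fn n)"
  let ?s = "\<lambda>n. monomial_sum b {..<n}"
  have c0: "0 \<le> ?c n" for n using N_monomial_pos[of n] by simp
  have sX: "?s n \<in> X" for n by (intro monomial_sum_in_X) simp
  have block: "N (\<lambda>z. ?s m z - ?s n z) \<le> sum ?c {n..<m}" if "n \<le> m" for m n
  proof -
    have "(\<lambda>z. ?s m z - ?s n z) = monomial_sum b {n..<m}"
      using that by (auto simp: monomial_sum_def fun_eq_iff lessThan_atLeast0 sum_diff_nat_ivl)
    then show ?thesis using N_monomial_sum_le[of "{n..<m}" b] by simp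
  qed
  have cauchy: "\<exists>M. \<forall>m\<ge>M. \<forall>n\<ge>M. N (\<lambda>z. ?s m z - ?s n z) < e" if e: "e > 0" for e
  proof -
    obtain M where M: "\<And>m n. m \<ge> M \<Longrightarrow> norm (sum ?c {m..<n}) < e"
      using summ e unfolding summable_Cauchy by meson
    have "N (\<lambda>z. ?s m z - ?s n z) < e" if "m \<ge> M" "n \<ge> M" for m n
    proof (cases "n \<le> m")
      case True
      then show ?thesis using block[OF True] M[OF that(2), of m] by force
    next
      case False
      then show ?thesis
        using block[of m n] M[OF that(1), of n] N_diff_commute[OF sX sX, of m n] by force
    qed
    then show ?thesis by blast
  qed
  obtain g where g: "g \<in> X" "(\<lambda>n. N (\<lambda>z. ?s n z - g z)) \<longlonglongrightarrow> 0"
    using X_complete[rule_format, of ?s, OF sX cauchy] by blast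
  define a where "a = (\<lambda>n. (deriv ^^ n) g 0 / fact n)"
  have ga: "disc_series g a" unfolding a_def by (rule disc_series_deriv[OF g(1)])
  \<comment> \<open>The k-th coefficient of the n-th partial sum is \<open>b k\<close> as soon as n
    > k, so \<open>coefficient_bound\<close> for the difference to \<open>g\<close> bounds a fixed
    quantity by a null sequence.\<close>
  have "a k = b k" for k
  proof -
    have "norm (b k - a k) * N (monomial_fn k) \<le> N (\<lambda>z. ?s n z - g z)" if "n > k" for n
      using coefficient_bound[OF X_diff[OF sX g(1)] disc_series_diff[OF disc_series_monomial_sum ga], of n k] that
      by simp
    then have "norm (b k - a k) * N (monomial_fn k) \<le> 0"
      by (intro LIMSEQ_le_const[OF g(2)]) (auto intro!: exI[of _ "Suc k"])
    then show ?thesis using N_monomial_pos[of k] by (simp add: mult_le_0_iff)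
  qed
  then have gb: "disc_series g b" using ga by (metis ext)
  have tail: "N (\<lambda>z. g z - ?s n z) \<le> (\<Sum>k. ?c (k + n))" for n
  proof -
    \<comment> \<open>The detour through the m-th partial sum isolates the unknown distance to
      \<open>g\<close>, which disappears as m tends to infinity.\<close>
    have "N (\<lambda>z. g z - ?s n z) \<le> N (\<lambda>z. ?s m z - g z) + (\<Sum>k. ?c (k + n))" if "m \<ge> n" for m
    proof -
      have "sum ?c {n..<m} = (\<Sum>k<m - n. ?c (k + n))"
        using sum.shift_bounds_nat_ivl[of ?c 0 n "m - n"] that by (simp add: lessThan_atLeast0)
      also have "\<dots> \<le> (\<Sum>k. ?c (k + n))"
        using summ c0 by (intro sum_le_suminf) (auto simp: summable_iff_shift[of ?c n])
      finally show ?thesis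
        using block[OF that] N_triangle[OF g(1) sX[of m] sX[of n]] N_diff_commute[OF g(1) sX[of m]] by simp
    qed
    moreover have "(\<lambda>m. N (\<lambda>z. ?s m z - g z) + (\<Sum>k. ?c (k + n))) \<longlonglongrightarrow> 0 + (\<Sum>k. ?c (k + n))"
      by (intro tendsto_intros g(2))
    ultimately show ?thesis
      by (intro LIMSEQ_le_const[of "\<lambda>m. N (\<lambda>z. ?s m z - g z) + (\<Sum>k. ?c (k + n))"]) auto
  qed
  show ?thesis using that[OF g(1) gb tail] .
qed

section \<open>Geometric bounds for the norms of monomials\<close>

text \<open>Axiom (ii) places the sum of the series in \<open>X\<close>, and its norm serves as
  \<open>B\<close>.\<close>

lemma coefficients_of_entire_bounded:
  fixes a :: "nat \<Rightarrow> complex"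
  assumes "\<And>z. summable (\<lambda>n. a n * z ^ n)"
  obtains B where "\<And>n. norm (a n) * N (monomial_fn n) \<le> B"
proof -
  let ?F = "\<lambda>z. \<Sum>n. a n * z ^ n"
  have "disc_series (restrD ?F) a"
    unfolding restrD_disc_series_iff by (simp add: disc_series_def summable_sums assms)
  then show ?thesis
    using that coefficient_bound[OF X_entire[OF entire_power_series[OF assms]]] by blast
qed

text \<open>Otherwise a norm convergent series of monomials would have radius of convergence less than \<open>1\<close>.\<close>
lemma eventually_N_monomial_ge:
  "eventually (\<lambda>n. (1/2) ^ n \<le> N (monomial_fn n)) sequentially"
proof (rule ccontr)
  assume "\<not> ?thesis"
  then have freq: "frequently (\<lambda>n. N (monomial_fn n) < (1/2) ^ n) sequentially"
    by (simp add: not_eventually not_le)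
  \<comment> \<open>At the bad indices 3/2 is small enough for the norms, (3/2)(1/2) = 3/4 < 1, yet
    too large for convergence at the point 3/4 of the disc, (3/2)(3/4) = 9/8 > 1.\<close>
  define b :: "nat \<Rightarrow> complex" where "b n = (if N (monomial_fn n) < (1/2) ^ n then (3/2) ^ n else 0)" for n
  have "norm (b n) * N (monomial_fn n) \<le> (3/4) ^ n" for n
  proof (cases "N (monomial_fn n) < (1/2) ^ n")
    case True
    then have "norm (b n) * N (monomial_fn n) \<le> (3/2) ^ n * (1/2) ^ n"
      by (simp add: b_def norm_power)
    also have "\<dots> = (3/4) ^ n" unfolding power_mult_distrib[symmetric] by simp
    finally show ?thesis .
  qed (simp add: b_def)
  then have "summable (\<lambda>n. norm (b n) * N (monomial_fn n))"
    using N_nonneg[OF monomial_in_X]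
    by (intro summable_comparison_test'[OF summable_geometric[of "3/4::real"]]) auto
  then obtain g where "disc_series g b" by (rule monomial_series_converges)
  then have "(\<lambda>n. b n * (3/4) ^ n) sums g (3/4)" unfolding disc_series_def by (rule bspec) simp
  then have "(\<lambda>n. b n * (3/4) ^ n) \<longlonglongrightarrow> 0" by (intro summable_LIMSEQ_zero sums_summable)
  then have "eventually (\<lambda>n. norm (b n * (3/4) ^ n) < 1) sequentially"
    by (auto dest: tendstoD[of _ _ _ 1])
  then obtain n where n: "N (monomial_fn n) < (1/2) ^ n" "norm (b n * (3/4) ^ n) < 1"
    using frequently_eventually_conj[OF freq] by (metis (mono_tags, lifting) frequently_ex)
  have "b n * (3/4) ^ n = (9/8) ^ n"
    using n(1) unfolding b_def by (simp flip: power_mult_distrib)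
  then have "norm (b n * (3/4) ^ n) = (9/8) ^ n" by (simp add: norm_power)
  moreover have "1 \<le> (9/8::real) ^ n" by (intro one_le_power) simp
  ultimately show False using n(2) by linarith
qed

text \<open>Otherwise, with \<open>h\<close> the running maximum of the roots \<open>\<parallel>z^n\<parallel>^(1/n)\<close>, the entire function with
  Taylor coefficients \<open>h n ^ (- n/2)\<close> would violate the coefficient bound at the record indices of \<open>h\<close>.\<close>
lemma eventually_N_monomial_le:
  shows "\<exists>R\<ge>1. eventually (\<lambda>n. N (monomial_fn n) \<le> R ^ n) sequentially"
proof (rule ccontr)
  assume contra: "\<not> ?thesis"
  have ex: "\<exists>n>0. R ^ n < N (monomial_fn n)" if "1 \<le> R" for R
  proof (rule ccontr)
    assume neg: "\<not> (\<exists>n>0. R ^ n < N (monomial_fn n))"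
    have "N (monomial_fn n) \<le> R ^ n" if "1 \<le> n" for n
      using neg that by (meson less_le_trans not_le zero_less_one)
    then have "eventually (\<lambda>n. N (monomial_fn n) \<le> R ^ n) sequentially"
      by (rule eventually_sequentiallyI)
    with \<open>1 \<le> R\<close> have "\<exists>R\<ge>1. eventually (\<lambda>n. N (monomial_fn n) \<le> R ^ n) sequentially"
      by (intro exI[of _ R] conjI)
    with contra show False by (rule notE)
  qed
  define L where "L n = root n (N (monomial_fn n))" for n
  define h where "h n = Max (insert 1 (L ` {..n}))" for n
  have h1: "1 \<le> h n" for n unfolding h_def by (intro Max_ge) auto
  have hL: "L n \<le> h n" for n unfolding h_def by (intro Max_ge) auto
  have hmono: "h m \<le> h n" if "m \<le> n" for m n
    unfolding h_def using that by (intro Max_mono) auto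
  have Lex: "\<exists>n. R < L n" if R: "1 \<le> R" for R
  proof -
    obtain n where "n > 0" "R ^ n < N (monomial_fn n)" using ex[OF R] by blast
    then have "R < L n"
      using R unfolding L_def by (metis order_trans real_root_less_iff real_root_power_cancel zero_le_one)
    then show ?thesis ..
  qed
  have hev: "eventually (\<lambda>n. R \<le> h n) sequentially" for R
  proof -
    obtain m where "max R 1 < L m" using Lex[of "max R 1"] by auto
    then have "R \<le> h n" if "n \<ge> m" for n using hL[of m] hmono[OF that] by linarith
    then show ?thesis by (auto simp: eventually_sequentially)
  qed
  \<comment> \<open>The square root balances two demands: \<open>h\<close> tends to infinity, so the
    coefficients still decay faster than any geometric sequence, while at a record index k their
    product with v_k = h(k)^k is h(k)^(k/2).\<close>
  define a :: "nat \<Rightarrow> complex" where "a n = of_real ((1 / sqrt (h n)) ^ n)" for n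
  have na: "norm (a n) = (1 / sqrt (h n)) ^ n" for n
    using h1[of n] by (simp add: a_def norm_power norm_divide)
  have summ: "summable (\<lambda>n. a n * z ^ n)" for z
  proof (rule summable_comparison_test_ev)
    show "eventually (\<lambda>n. norm (a n * z ^ n) \<le> (1/2) ^ n) sequentially"
      using hev[of "(2 * norm z)\<^sup>2"]
    proof eventually_elim
      case (elim n)
      then have "2 * norm z \<le> sqrt (h n)" by (rule real_le_rsqrt)
      then have "1 / sqrt (h n) * norm z \<le> 1/2" using h1[of n] by (simp add: field_simps)
      then have "(1 / sqrt (h n) * norm z) ^ n \<le> (1/2) ^ n"
        using h1[of n] by (intro power_mono) auto
      then show ?case unfolding norm_mult na norm_power power_mult_distrib .
    qed
  qed (simp add: summable_geometric)
  obtain B where B: "\<And>n. norm (a n) * N (monomial_fn n) \<le> B"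
    using coefficients_of_entire_bounded[OF summ] by blast
  \<comment> \<open>The square makes the square root of the record exceed |B| + 1; the added 1 keeps
    the record above 1, the value inserted into the maximum.\<close>
  obtain m where m: "(\<bar>B\<bar> + 1)\<^sup>2 < L m" using Lex[of "(\<bar>B\<bar> + 1)\<^sup>2"] by auto
  have B1: "1 \<le> (\<bar>B\<bar> + 1)\<^sup>2" by (intro one_le_power) simp
  have hm: "(\<bar>B\<bar> + 1)\<^sup>2 < h m" "1 < h m"
    using m hL[of m] B1 by linarith+
  have "h m \<in> insert 1 (L ` {..m})" unfolding h_def by (intro Max_in) auto
  \<comment> \<open>The index where the maximum is attained is a record: L k <= h k <= h m = L
    k.\<close>
  then obtain k where k: "k \<le> m" "h m = L k" using hm(2) by auto
  have hk: "h k = L k" using hmono[OF k(1)] hL[of k] k(2) by simp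
  \<comment> \<open>By convention \<open>root 0\<close> is 0, so index 0 cannot carry a record above
    1.\<close>
  have k0: "k > 0" using hm(2) k(2) by (cases "k = 0") (auto simp: L_def)
  have Lk: "(\<bar>B\<bar> + 1)\<^sup>2 < L k" "1 < L k" using hm k(2) by auto
  have "N (monomial_fn k) = L k ^ k"
    using k0 N_nonneg[OF monomial_in_X] by (simp add: L_def)
  then have "norm (a k) * N (monomial_fn k) = (1 / sqrt (L k) * L k) ^ k"
    unfolding na hk power_mult_distrib by simp
  also have "1 / sqrt (L k) * L k = sqrt (L k)"
    using Lk(2) by (simp add: real_div_sqrt)
  finally have "norm (a k) * N (monomial_fn k) = sqrt (L k) ^ k" .
  moreover have "sqrt (L k) \<le> sqrt (L k) ^ k" using Lk(2) k0 by (intro self_le_power) auto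
  moreover have "\<bar>B\<bar> + 1 < sqrt (L k)" using Lk(1) by (rule real_less_rsqrt)
  ultimately show False using B[of k] by linarith
qed

section \<open>Best approximation against Taylor coefficients\<close>

lemma restrD_poly_in_X: "restrD (poly p) \<in> X"
  by (intro X_entire holomorphic_intros)

lemma best_approx_le:
  assumes "f \<in> X" "degree p < n"
  shows "best_approx N n f \<le> N (\<lambda>z. f z - restrD (poly p) z)"
  unfolding best_approx_def using assms
  by (intro cINF_lower bdd_belowI2[of _ 0]) (auto intro!: N_nonneg X_diff restrD_poly_in_X)

text \<open>For n > 0 the zero polynomial competes, so the infimum is over a nonempty set.\<close>

lemma best_approx_greatest:
  assumes "n > 0" "\<And>p. degree p < n \<Longrightarrow> c \<le> N (\<lambda>z. f z - restrD (poly p) z)"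
  shows "c \<le> best_approx N n f"
  unfolding best_approx_def using assms by (intro cINF_greatest) (auto intro!: exI[of _ 0])

lemma best_approx_nonneg: "f \<in> X \<Longrightarrow> n > 0 \<Longrightarrow> 0 \<le> best_approx N n f"
  by (intro best_approx_greatest N_nonneg X_diff restrD_poly_in_X)

lemma best_approx_antimono:
  "f \<in> X \<Longrightarrow> 0 < m \<Longrightarrow> m \<le> n \<Longrightarrow> best_approx N n f \<le> best_approx N m f"
  by (intro best_approx_greatest best_approx_le) auto

lemma coefficient_le_best_approx:
  assumes "f \<in> X" "disc_series f a" "n > 0"
  shows "norm (a n) * N (monomial_fn n) \<le> best_approx N n f"
proof (rule best_approx_greatest[OF assms(3)])
  fix p :: "complex poly" assume p: "degree p < n"
  have "disc_series (restrD (poly p)) (coeff p)"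
    unfolding restrD_disc_series_iff by (simp add: disc_series_def poly_sums)
  from coefficient_bound[OF X_diff[OF assms(1) restrD_poly_in_X] disc_series_diff[OF assms(2) this], of n]
  show "norm (a n) * N (monomial_fn n) \<le> N (\<lambda>z. f z - restrD (poly p) z)"
    using p by (simp add: coeff_eq_0)
qed

text \<open>The competitor is the Taylor polynomial. Its distance to the norm limit of the series is
  the tail, and this limit is \<open>f\<close> because the coefficients agree.\<close>

lemma best_approx_le_tail:
  assumes "f \<in> X" "disc_series f a" "summable (\<lambda>n. norm (a n) * N (monomial_fn n))" "n > 0"
  shows "best_approx N n f \<le> (\<Sum>k. norm (a (k + n)) * N (monomial_fn (k + n)))"
proof -
  obtain g where g: "g \<in> X" "disc_series g a"
    "N (\<lambda>z. g z - monomial_sum a {..<n} z) \<le> (\<Sum>k. norm (a (k + n)) * N (monomial_fn (k + n)))"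
    using monomial_series_converges[OF assms(3)] by metis
  have "g = f" using disc_series_inj g(1,2) assms(1,2) by blast
  define p where "p = (\<Sum>k<n. monom (a k) k)"
  have "degree p < n" unfolding p_def
    using assms(4) by (intro degree_sum_less) (auto intro: le_less_trans[OF degree_monom_le])
  moreover have "monomial_sum a {..<n} = restrD (poly p)"
    by (auto simp: monomial_sum_def monomial_fn_def restrD_def p_def poly_sum poly_monom fun_eq_iff)
  ultimately show ?thesis using best_approx_le[OF assms(1), of p n] g(3) \<open>g = f\<close> by simp
qed

text \<open>With the logarithm cleared, E_n(f) = 0 needs no exception. For \<sigma> > 0 and n >= 2
  the inequality also excludes E_n(f) >= v_n, which a bound on the quotient would permit.\<close>

definition approx_below :: "(complex \<Rightarrow> complex) \<Rightarrow> real \<Rightarrow> bool" where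
  "approx_below f \<sigma> \<longleftrightarrow>
     eventually (\<lambda>n. best_approx N n f \<le> N (monomial_fn n) * order_decay \<sigma> n) sequentially"

lemma approx_below_imp_coeffs_below:
  assumes "f \<in> X" "disc_series f a" "approx_below f \<sigma>"
  shows "coeffs_below a \<sigma>"
  using assms(3) eventually_gt_at_top[of 0] unfolding approx_below_def coeffs_below_def
proof eventually_elim
  case (elim n)
  then have "norm (a n) * N (monomial_fn n) \<le> order_decay \<sigma> n * N (monomial_fn n)"
    using coefficient_le_best_approx[OF assms(1,2), of n] by (simp add: mult.commute)
  then show ?case using N_monomial_pos[of n] by simp
qed

lemma coeffs_below_imp_approx_below:
  assumes "f \<in> X" "disc_series f a" "0 < \<sigma>" "\<sigma> < \<sigma>'" "coeffs_below a \<sigma>"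
  shows "approx_below f \<sigma>'"
proof -
  obtain R where R: "1 \<le> R" "eventually (\<lambda>n. N (monomial_fn n) \<le> R ^ n) sequentially"
    using eventually_N_monomial_le by blast
  let ?c = "\<lambda>n. norm (a n) * N (monomial_fn n)"
  have c0: "0 \<le> ?c n" for n using N_monomial_pos[of n] by simp
  \<comment> \<open>R^n pays for v_n in the tail; 4^n leaves a ratio 1/4, which makes the tail
    summable and small against the lower bound (1/2)^n for v_n.\<close>
  have "eventually (\<lambda>n. (4 * R) ^ n * order_decay \<sigma> n \<le> order_decay \<sigma>' n) sequentially"
    using assms R by (intro eventually_order_decay_absorbs_power) auto
  with R(2) assms(5)[unfolded coeffs_below_def]
  have "eventually (\<lambda>n. ?c n \<le> order_decay \<sigma>' n * (1/4) ^ n) sequentially"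
  proof eventually_elim
    case (elim n)
    have "?c n \<le> order_decay \<sigma> n * R ^ n"
      using elim N_monomial_pos[of n] by (intro mult_mono) auto
    also have "\<dots> = (4 * R) ^ n * order_decay \<sigma> n * (1/4) ^ n"
      by (simp add: power_mult_distrib power_one_over)
    also have "\<dots> \<le> order_decay \<sigma>' n * (1/4) ^ n"
      using elim by (intro mult_right_mono) auto
    finally show ?case .
  qed
  then obtain M where M: "\<And>n. n \<ge> M \<Longrightarrow> ?c n \<le> order_decay \<sigma>' n * (1/4) ^ n"
    by (auto simp: eventually_sequentially)
  have "?c n \<le> (1/4) ^ n" if "n \<ge> M" for n
  proof -
    have "?c n \<le> order_decay \<sigma>' n * (1/4) ^ n" by (rule M[OF that])
    also have "\<dots> \<le> 1 * (1/4) ^ n"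
      using assms by (intro mult_right_mono order_decay_le_one) auto
    finally show ?thesis by simp
  qed
  then have summ: "summable ?c"
    using c0 by (intro summable_comparison_test'[OF summable_geometric[of "1/4::real"], of M]) auto
  have tail: "(\<Sum>k. ?c (k + n)) \<le> order_decay \<sigma>' n * (1/2) ^ n" if n: "n \<ge> M" "n > 0" for n
  proof -
    have le: "?c (k + n) \<le> order_decay \<sigma>' n * (1/4) ^ n * (1/4) ^ k" for k
    proof -
      have "?c (k + n) \<le> order_decay \<sigma>' (k + n) * (1/4) ^ (k + n)" using M n by simp
      also have "\<dots> \<le> order_decay \<sigma>' n * (1/4) ^ (k + n)"
        using assms by (intro mult_right_mono order_decay_antimono) auto
      finally show ?thesis by (simp add: power_add mult_ac)
    qed
    have s: "(\<lambda>k. order_decay \<sigma>' n * (1/4) ^ n * (1/4) ^ k) sums (order_decay \<sigma>' n * (1/4) ^ n * (4/3))"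
      using geometric_sums[of "1/4::real"] by (intro sums_mult) auto
    have "(\<Sum>k. ?c (k + n)) \<le> (\<Sum>k. order_decay \<sigma>' n * (1/4) ^ n * (1/4) ^ k)"
      using le summ s by (intro suminf_le) (auto simp: summable_iff_shift[of ?c n] sums_iff)
    also have "\<dots> = order_decay \<sigma>' n * ((1/4) ^ n * (4/3))" using s by (simp add: sums_iff)
    \<comment> \<open>This needs n >= 1: the spare factor (1/2)^n <= 1/2 outweighs the 4/3 from the
      geometric sum.\<close>
    also have "(1/4::real) ^ n * (4/3) \<le> (1/2) ^ n"
    proof -
      have "(1/4::real) ^ n = (1/2) ^ n * (1/2) ^ n" unfolding power_mult_distrib[symmetric] by simp
      moreover have "(1/2::real) ^ n \<le> (1/2) ^ 1" using n by (intro power_decreasing) auto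
      ultimately show ?thesis by (simp add: mult_left_le)
    qed
    finally show ?thesis by simp
  qed
  show ?thesis unfolding approx_below_def
    using eventually_N_monomial_ge eventually_ge_at_top[of M] eventually_gt_at_top[of 0]
  proof eventually_elim
    case (elim n)
    have "best_approx N n f \<le> order_decay \<sigma>' n * (1/2) ^ n"
      using best_approx_le_tail[OF assms(1,2) summ, of n] tail[of n] elim by linarith
    also have "\<dots> \<le> order_decay \<sigma>' n * N (monomial_fn n)"
      using elim by (intro mult_left_mono) auto
    finally show ?case by (simp add: mult.commute)
  qed
qed

section \<open>Comparison of the two orders\<close>

definition approx_order :: "(complex \<Rightarrow> complex) \<Rightarrow> ereal" where
  "approx_order f = limsup (\<lambda>n. if best_approx N n f = 0 then ereal 0
     else ereal (real n * ln (real n) / ln (N (monomial_fn n) / best_approx N n f)))"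

lemma approx_below_imp_approx_order_le:
  assumes "f \<in> X" "0 < \<sigma>" "approx_below f \<sigma>"
  shows "approx_order f \<le> ereal \<sigma>"
  unfolding approx_order_def
proof (rule Limsup_bounded)
  show "eventually (\<lambda>n. (if best_approx N n f = 0 then ereal 0
     else ereal (real n * ln (real n) / ln (N (monomial_fn n) / best_approx N n f))) \<le> ereal \<sigma>) sequentially"
    \<comment> \<open>From n = 2 on, n ln n is positive; this makes ln(v_n / E_n(f)) positive, so
      that dividing by it preserves the inequality.\<close>
    using assms(3)[unfolded approx_below_def] eventually_ge_at_top[of 2]
  proof eventually_elim
    case (elim n)
    show ?case
    proof (cases "best_approx N n f = 0")
      case False
      then have E: "0 < best_approx N n f" using best_approx_nonneg[OF assms(1), of n] elim by simp
      have "exp (real n * ln (real n) / \<sigma>) \<le> N (monomial_fn n) / best_approx N n f"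
        using elim(1) E by (simp add: order_decay_def exp_minus field_simps)
      then have "real n * ln (real n) / \<sigma> \<le> ln (N (monomial_fn n) / best_approx N n f)"
        using E N_monomial_pos[of n] by (simp add: ln_ge_iff)
      moreover have "0 < real n * ln (real n) / \<sigma>" using elim assms by simp
      ultimately have "0 < ln (N (monomial_fn n) / best_approx N n f)"
        and "real n * ln (real n) \<le> \<sigma> * ln (N (monomial_fn n) / best_approx N n f)"
        using assms(2) by (linarith, simp only: pos_divide_le_eq mult.commute[of \<sigma>])
      then have "real n * ln (real n) / ln (N (monomial_fn n) / best_approx N n f) \<le> \<sigma>"
        by (simp only: pos_divide_le_eq)
      then show ?thesis using False by simp
    qed (use assms in simp)
  qed
qed

text \<open>The hypothesis \<open>approx_order f < \<sigma>\<close> is void at indices with \<open>E_n \<ge> \<parallel>z^n\<parallel>\<close>, where the logarithm is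
  not positive. Such an index cannot follow a large index with \<open>E_n\<close> small, because \<open>E_n\<close> decreases and
  \<open>\<parallel>z^n\<parallel>\<close> lies between two geometric sequences.\<close>
lemma approx_order_less_imp_approx_below:
  assumes "f \<in> X" "0 < \<sigma>" "approx_order f < ereal \<sigma>"
    and freq: "frequently (\<lambda>n. best_approx N n f < N (monomial_fn n)) sequentially"
  shows "approx_below f \<sigma>"
proof -
  obtain R where R: "1 \<le> R" "eventually (\<lambda>n. N (monomial_fn n) \<le> R ^ n) sequentially"
    using eventually_N_monomial_le by blast
  define good where "good n \<longleftrightarrow> best_approx N n f \<le> N (monomial_fn n) * order_decay \<sigma> n" for n
  have "eventually (\<lambda>n. (if best_approx N n f = 0 then ereal 0
     else ereal (real n * ln (real n) / ln (N (monomial_fn n) / best_approx N n f))) < ereal \<sigma>) sequentially"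
    using assms(3) unfolding approx_order_def by (rule Limsup_lessD)
  then have dich: "eventually (\<lambda>n. best_approx N n f < N (monomial_fn n) \<longrightarrow> good n) sequentially"
    using eventually_ge_at_top[of 2]
  proof eventually_elim
    case (elim n)
    show ?case
    proof
      assume less: "best_approx N n f < N (monomial_fn n)"
      show "good n"
      proof (cases "best_approx N n f = 0")
        case True
        then show ?thesis using N_monomial_pos[of n] by (simp add: good_def less_imp_le)
      next
        case False
        then have E: "0 < best_approx N n f" using best_approx_nonneg[OF assms(1), of n] elim by simp
        let ?q = "N (monomial_fn n) / best_approx N n f"
        have q: "1 < ?q" using less E by simp
        have "real n * ln (real n) / ln ?q < \<sigma>" using elim(1) False by simp
        then have "real n * ln (real n) < \<sigma> * ln ?q"
          using ln_gt_zero[OF q] by (simp only: pos_divide_less_eq)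
        then have "real n * ln (real n) / \<sigma> \<le> ln ?q"
          using assms(2) by (simp only: pos_divide_le_eq mult.commute[of \<sigma>] less_imp_le)
        then have "exp (real n * ln (real n) / \<sigma>) \<le> ?q" using q by (simp only: ln_ge_iff)
        then show ?thesis using E by (simp add: good_def order_decay_def exp_minus field_simps)
      qed
    qed
  qed
  \<comment> \<open>The ratio 1/4 is chosen so that (1/4)^n < (1/2)^(n+1) for n >= 2, which is below
    the eventual lower bound for v_(n+1).\<close>
  have "eventually (\<lambda>n. R ^ n * order_decay \<sigma> n \<le> (1/4) ^ n) sequentially"
    using assms R by (intro eventually_order_decay_mult_power_le) auto
  with R(2) have step: "eventually (\<lambda>n. good n \<longrightarrow> best_approx N (Suc n) f < (1/2) ^ Suc n) sequentially"
    using eventually_ge_at_top[of 2]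
  proof eventually_elim
    case (elim n)
    show ?case
    proof
      assume "good n"
      have "best_approx N (Suc n) f \<le> best_approx N n f"
        using elim assms(1) by (intro best_approx_antimono) auto
      also have "\<dots> \<le> R ^ n * order_decay \<sigma> n"
        using \<open>good n\<close> elim(1) unfolding good_def by (meson mult_right_mono order_decay_pos(2) order_trans)
      also have "\<dots> \<le> (1/4) ^ n" by (rule elim)
      also have "\<dots> = (1/2) ^ (2 * n)" by (simp add: power_mult power2_eq_square)
      also have "\<dots> < (1/2) ^ Suc n" using elim by (intro power_strict_decreasing) auto
      finally show "best_approx N (Suc n) f < (1/2) ^ Suc n" .
    qed
  qed
  obtain M where M: "\<And>n. n \<ge> M \<Longrightarrow> best_approx N n f < N (monomial_fn n) \<Longrightarrow> good n"
      "\<And>n. n \<ge> M \<Longrightarrow> good n \<Longrightarrow> best_approx N (Suc n) f < (1/2) ^ Suc n"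
      "\<And>n. n \<ge> M \<Longrightarrow> (1/2) ^ n \<le> N (monomial_fn n)"
    using eventually_conj[OF dich eventually_conj[OF step eventually_N_monomial_ge]]
    unfolding eventually_sequentially by blast
  obtain m where m: "m \<ge> M" "best_approx N m f < N (monomial_fn m)"
    using freq unfolding frequently_sequentially by blast
  \<comment> \<open>A good index n makes E_(n+1)(f) < v_(n+1), and beyond \<open>M\<close> this
    makes n + 1 good; \<open>freq\<close> supplies the start.\<close>
  have "good n" if "n \<ge> m" for n
    using that
  proof (induction n rule: dec_induct)
    case base
    then show ?case using M(1) m by blast
  next
    case (step n)
    then have "best_approx N (Suc n) f < N (monomial_fn (Suc n))"
      using M(2)[of n] M(3)[of "Suc n"] m(1) by simp
    then show ?case using M(1)[of "Suc n"] step m(1) by simp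
  qed
  then show ?thesis unfolding approx_below_def good_def eventually_sequentially by blast
qed

lemma growth_below_imp_approx_below:
  assumes "f \<in> X" "F holomorphic_on UNIV" "\<forall>z\<in>ball 0 1. f z = F z"
    "0 < \<sigma>" "\<sigma> < \<sigma>'" "growth_below F \<sigma>"
  shows "approx_below f \<sigma>'"
proof -
  \<comment> \<open>Two lossy steps follow, from growth to coefficients and from coefficients to
    approximation, so an exponent in between is needed.\<close>
  obtain \<tau> where \<tau>: "\<sigma> < \<tau>" "\<tau> < \<sigma>'" using dense[OF assms(5)] by blast
  have "disc_series f (\<lambda>n. (deriv ^^ n) F 0 / fact n)"
    using entire_taylor_sums[OF assms(2)] assms(3) by (simp add: disc_series_def)
  moreover have "coeffs_below (\<lambda>n. (deriv ^^ n) F 0 / fact n) \<tau>"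
    by (rule growth_below_imp_coeffs_below[OF assms(4) \<tau>(1) assms(2,6)])
  ultimately show ?thesis using assms(1,4) \<tau> by (intro coeffs_below_imp_approx_below) auto
qed

lemma approx_below_imp_growth_below:
  assumes "f \<in> X" "F holomorphic_on UNIV" "\<forall>z\<in>ball 0 1. f z = F z"
    "0 < \<sigma>" "\<sigma> < \<sigma>'" "approx_below f \<sigma>"
  shows "growth_below F \<sigma>'"
proof -
  have "disc_series f (\<lambda>n. (deriv ^^ n) F 0 / fact n)"
    using entire_taylor_sums[OF assms(2)] assms(3) by (simp add: disc_series_def)
  then have "coeffs_below (\<lambda>n. (deriv ^^ n) F 0 / fact n) \<sigma>"
    by (rule approx_below_imp_coeffs_below[OF assms(1) _ assms(6)])
  then show ?thesis
    using entire_taylor_sums[OF assms(2)] by (intro coeffs_below_imp_growth_below[OF assms(4,5)])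
qed

lemma approx_below_imp_entire:
  assumes "f \<in> X" "0 < \<sigma>" "approx_below f \<sigma>"
  obtains F where "F holomorphic_on UNIV" "\<forall>z\<in>ball 0 1. f z = F z"
proof -
  define a where "a n = (deriv ^^ n) f 0 / fact n" for n
  have a: "disc_series f a"
    unfolding a_def by (rule disc_series_deriv[OF assms(1)])
  have s: "summable (\<lambda>n. a n * z ^ n)" for z
    using coeffs_below_summable[OF assms(2) approx_below_imp_coeffs_below[OF assms(1) a assms(3)]]
    by (rule summable_norm_cancel)
  show ?thesis
    using that[OF entire_power_series[of a, OF s]] a by (simp add: disc_series_def sums_iff)
qed

text \<open>A strict inequality leaves room for exponents \<tau> < \<sigma>' < \<rho> that absorb
  the losses. The crude bound with \<rho>' ensures E_n(f) < v_n eventually, without which a small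
  \<open>approx_order\<close> gives no information.\<close>

lemma entire_order_less_iff_approx_order_less:
  assumes f: "f \<in> X" and F: "F holomorphic_on UNIV" "\<forall>z\<in>ball 0 1. f z = F z"
    and below: "0 < \<rho>'" "approx_below f \<rho>'" and "0 < \<rho>"
  shows "entire_order F < ereal \<rho> \<longleftrightarrow> approx_order f < ereal \<rho>"
proof
  assume "entire_order F < ereal \<rho>"
  then obtain \<tau> where \<tau>: "0 < \<tau>" "\<tau> < \<rho>" "entire_order F < ereal \<tau>"
    using \<open>0 < \<rho>\<close> by (rule ereal_less_obtain_pos)
  obtain \<sigma>' where "\<tau> < \<sigma>'" "\<sigma>' < \<rho>" using dense[OF \<tau>(2)] by blast
  then have "approx_order f \<le> ereal \<sigma>'"
    using entire_order_less_imp_growth_below[OF F(1) \<tau>(3)] \<tau> f F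
    by (intro approx_below_imp_approx_order_le[OF f] growth_below_imp_approx_below[where \<sigma> = \<tau> and F = F]) auto
  then show "approx_order f < ereal \<rho>" using \<open>\<sigma>' < \<rho>\<close> by (simp add: le_less_trans)
next
  have "eventually (\<lambda>n. best_approx N n f < N (monomial_fn n)) sequentially"
    using below(2)[unfolded approx_below_def] eventually_ge_at_top[of 2]
  proof eventually_elim
    case (elim n)
    have "order_decay \<rho>' n < 1" using elim below(1) by (simp add: order_decay_def)
    then have "N (monomial_fn n) * order_decay \<rho>' n < N (monomial_fn n)"
      using N_monomial_pos[of n] by simp
    with elim show ?case by linarith
  qed
  then have freq: "frequently (\<lambda>n. best_approx N n f < N (monomial_fn n)) sequentially"
    by (intro eventually_frequently) auto
  assume "approx_order f < ereal \<rho>"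
  then obtain \<tau> where \<tau>: "0 < \<tau>" "\<tau> < \<rho>" "approx_order f < ereal \<tau>"
    using \<open>0 < \<rho>\<close> by (rule ereal_less_obtain_pos)
  obtain \<sigma>' where "\<tau> < \<sigma>'" "\<sigma>' < \<rho>" using dense[OF \<tau>(2)] by blast
  then have "entire_order F \<le> ereal \<sigma>'"
    using approx_order_less_imp_approx_below[OF f \<tau>(1,3) freq] \<tau> f F
    by (intro growth_below_imp_entire_order_le[OF F(1)] approx_below_imp_growth_below[where \<sigma> = \<tau> and f = f]) auto
  then show "entire_order F < ereal \<rho>" using \<open>\<sigma>' < \<rho>\<close> by (simp add: le_less_trans)
qed

text \<open>Being at most \<rho> means being below every \<sigma> > \<rho>, so the strict
  comparisons at all positive reals decide equality with \<rho>.\<close>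

lemma entire_order_eq_iff_approx_order_eq:
  assumes f: "f \<in> X" and F: "F holomorphic_on UNIV" "\<forall>z\<in>ball 0 1. f z = F z"
    and below: "0 < \<rho>'" "approx_below f \<rho>'" and "0 < \<rho>"
  shows "entire_order F = ereal \<rho> \<longleftrightarrow> approx_order f = ereal \<rho>"
proof -
  note less_iff = entire_order_less_iff_approx_order_less[OF f F below]
  have "entire_order F \<le> ereal \<rho> \<longleftrightarrow> approx_order f \<le> ereal \<rho>"
  proof -
    have "x \<le> ereal \<rho> \<longleftrightarrow> (\<forall>\<sigma>>\<rho>. x < ereal \<sigma>)" for x
      by (meson ereal_dense2 ereal_less_eq(3) le_less_trans less_ereal.simps(1) less_asym' not_le)
    then show ?thesis using less_iff \<open>0 < \<rho>\<close> by (metis order_less_trans)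
  qed
  then show ?thesis using less_iff[OF \<open>0 < \<rho>\<close>] by (metis order_le_less order_less_irrefl)
qed

text \<open>If E_n(f) >= v_n from some index on, the logarithms are at most 0 and so are the
  quotients, including E_n(f) = v_n, where division by 0 yields 0. The positivity of \<rho> rules
  this out in the converse direction.\<close>

lemma approx_order_pos_imp_frequently:
  assumes "f \<in> X" "0 < approx_order f"
  shows "frequently (\<lambda>n. best_approx N n f < N (monomial_fn n)) sequentially"
proof (rule ccontr)
  assume "\<not> ?thesis"
  then have "eventually (\<lambda>n. N (monomial_fn n) \<le> best_approx N n f) sequentially"
    by (simp add: not_frequently not_less)
  then have "eventually (\<lambda>n. (if best_approx N n f = 0 then ereal 0
     else ereal (real n * ln (real n) / ln (N (monomial_fn n) / best_approx N n f))) \<le> 0) sequentially"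
    using eventually_gt_at_top[of 0]
  proof eventually_elim
    case (elim n)
    then have "0 < N (monomial_fn n) / best_approx N n f" "N (monomial_fn n) / best_approx N n f \<le> 1"
      using N_monomial_pos[of n] by (auto simp: divide_le_eq_1)
    then have "ln (N (monomial_fn n) / best_approx N n f) \<le> 0" by (simp only: ln_le_zero_iff)
    then have "real n * ln (real n) / ln (N (monomial_fn n) / best_approx N n f) \<le> 0"
      using elim by (intro divide_nonneg_nonpos) auto
    then show ?case by simp
  qed
  then have "approx_order f \<le> 0" unfolding approx_order_def by (rule Limsup_bounded)
  with assms(2) show False by simp
qed

end

theorem theorem2p2:
  fixes X :: "(complex \<Rightarrow> complex) set" and N :: "(complex \<Rightarrow> complex) \<Rightarrow> real"
    and f :: "complex \<Rightarrow> complex" and \<rho> :: real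
  assumes "admissible_space X N" and "f \<in> X" and "0 < \<rho>"
  shows "(\<exists>F. F holomorphic_on UNIV \<and> (\<forall>z\<in>ball 0 1. f z = F z) \<and> entire_order F = ereal \<rho>)
     \<longleftrightarrow> limsup (\<lambda>n. if best_approx N n f = 0 then ereal 0
              else ereal (real n * ln (real n) / ln (N (monomial_fn n) / best_approx N n f))) = ereal \<rho>"
proof -
  interpret admissible X N by standard (rule assms(1))
  have lt: "ereal \<rho> < ereal (\<rho> + 1)" by simp
  have "(\<exists>F. F holomorphic_on UNIV \<and> (\<forall>z\<in>ball 0 1. f z = F z) \<and> entire_order F = ereal \<rho>)
     \<longleftrightarrow> approx_order f = ereal \<rho>"
  proof
    assume "\<exists>F. F holomorphic_on UNIV \<and> (\<forall>z\<in>ball 0 1. f z = F z) \<and> entire_order F = ereal \<rho>"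
    then obtain F where F: "F holomorphic_on UNIV" "\<forall>z\<in>ball 0 1. f z = F z"
      and ord: "entire_order F = ereal \<rho>" by blast
    \<comment> \<open>A crude exponent suffices: it only supplies the \<open>approx_below\<close>
      hypothesis of the equality lemma, which then gives the exact order.\<close>
    have "growth_below F (\<rho> + 1)"
      using entire_order_less_imp_growth_below[OF F(1)] lt ord by metis
    then have "approx_below f (\<rho> + 2)"
      using assms(2,3) F by (intro growth_below_imp_approx_below[where F = F and \<sigma> = "\<rho> + 1"]) auto
    then show "approx_order f = ereal \<rho>"
      using entire_order_eq_iff_approx_order_eq[OF assms(2) F _ _ assms(3), of "\<rho> + 2"] ord assms(3) by simp
  next
    assume ord: "approx_order f = ereal \<rho>"
    \<comment> \<open>This must come first: the decay it asserts is what produces the entire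
      extension whose order is then compared.\<close>
    have "approx_below f (\<rho> + 1)"
      using approx_order_pos_imp_frequently[OF assms(2)] ord assms lt
      by (intro approx_order_less_imp_approx_below) auto
    moreover from this obtain F where F: "F holomorphic_on UNIV" "\<forall>z\<in>ball 0 1. f z = F z"
      using approx_below_imp_entire[OF assms(2), of "\<rho> + 1"] assms(3) by auto
    ultimately have "entire_order F = ereal \<rho>"
      using entire_order_eq_iff_approx_order_eq[OF assms(2) F _ _ assms(3), of "\<rho> + 1"] ord assms(3) by simp
    with F show "\<exists>F. F holomorphic_on UNIV \<and> (\<forall>z\<in>ball 0 1. f z = F z) \<and> entire_order F = ereal \<rho>"
      by blast
  qed
  then show ?thesis unfolding approx_order_def .
qed

end
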